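(* Let $G$ be a graph on $n \geq 2$ vertices with maximum degree $\Delta$, and let $\gamma_\alpha(G) = \Delta - \rho_\alpha(G)$. For $0 \leq \alpha < 1$, $$\gamma_\alpha(G) \leq n - 1 - \frac{\alpha n}{2} - \frac{\sqrt{\alpha^2 n^2 + 4(1-2\alpha)(n-1)}}{2},$$ with equality if and only if $G \cong S_n$.
   Context: All graphs are finite, simple and undirected. For a graph $G$, $A(G)$ is its adjacency matrix and $D(G)$ the diagonal matrix of vertex degrees. For $\alpha\in[0,1]$, $A_\alpha(G) = \alpha D(G) + (1-\alpha)A(G)$, and $\rho_\alpha(G)$ is the largest eigenvalue of $A_\alpha(G)$. $S_n$ is the star on $n$ vertices.
   Formalization: The equality characterization excludes the edgeless graph on n = 2 vertices, for which both sides equal 0 (so equality holds) although it is not isomorphic to S_2; the inequality itself is stated for all graphs. *)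

theory Defs
  imports
    "Graph_Theory.Graph_Theory"
    "Jordan_Normal_Form.Spectral_Radius"
begin

text \<open>
  Finite simple undirected graphs are the locale \<^locale>\<open>graph\<close>: finite loop-free digraphs without
  parallel arcs whose arc relation is symmetric. An undirected edge is a pair of opposite arcs, so
  the degree of a vertex equals its \<^const>\<open>out_degree\<close>.

  A list \<open>vs\<close> enumerating the vertices without repetition fixes the order of the rows and columns
  of the matrices below.
\<close>

definition vertex_ordering :: "('a, 'b) pre_digraph \<Rightarrow> 'a list \<Rightarrow> bool" where
  "vertex_ordering G vs \<longleftrightarrow> distinct vs \<and> set vs = verts G"

definition adjacency_mat :: "('a, 'b) pre_digraph \<Rightarrow> 'a list \<Rightarrow> real mat" where
  "adjacency_mat G vs =
     mat (length vs) (length vs) (\<lambda>(i, j). if vs ! i \<rightarrow>\<^bsub>G\<^esub> vs ! j then 1 else 0)"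

definition degree_mat :: "('a, 'b) pre_digraph \<Rightarrow> 'a list \<Rightarrow> real mat" where
  "degree_mat G vs =
     mat (length vs) (length vs) (\<lambda>(i, j). if i = j then real (out_degree G (vs ! i)) else 0)"

definition A_alpha :: "real \<Rightarrow> ('a, 'b) pre_digraph \<Rightarrow> 'a list \<Rightarrow> real mat" where
  "A_alpha \<alpha> G vs = \<alpha> \<cdot>\<^sub>m degree_mat G vs + (1 - \<alpha>) \<cdot>\<^sub>m adjacency_mat G vs"

definition rho_alpha :: "real \<Rightarrow> ('a, 'b) pre_digraph \<Rightarrow> 'a list \<Rightarrow> real" where
  "rho_alpha \<alpha> G vs = Max (spectrum (A_alpha \<alpha> G vs))"

definition max_degree :: "('a, 'b) pre_digraph \<Rightarrow> nat" where
  "max_degree G = Max (out_degree G ` verts G)"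

definition gamma_alpha :: "real \<Rightarrow> ('a, 'b) pre_digraph \<Rightarrow> 'a list \<Rightarrow> real" where
  "gamma_alpha \<alpha> G vs = real (max_degree G) - rho_alpha \<alpha> G vs"

definition star :: "nat \<Rightarrow> nat pair_pre_digraph" where
  "star n = \<lparr> pverts = {0..<n}, parcs = {0} \<times> {1..<n} \<union> {1..<n} \<times> {0} \<rparr>"

end

theory Submission
  imports Defs "HOL-Analysis.Function_Topology"
begin

text \<open>
  Let \<open>u\<close> have maximum degree \<open>\<Delta>\<close> and write \<open>x(\<Delta>)\<close> for the larger root of
  \<open>(x - \<alpha> \<Delta>) (x - \<alpha>) = (1 - \<alpha>)\<^sup>2 \<Delta>\<close>, the largest eigenvalue of the star with \<open>\<Delta>\<close> leaves.
  The Perron vector of that star, extended by zero, is a test vector on \<open>G\<close>. The quadratic form of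
  \<open>A\<^sub>\<alpha>(G)\<close> is a sum over arcs with nonnegative summands at nonnegative vectors, so its Rayleigh
  quotient shows that the largest eigenvalue of \<open>G\<close> is at least \<open>x(\<Delta>)\<close>, strictly if
  \<open>\<Delta> = n - 1\<close> and there is an edge avoiding \<open>u\<close>. As \<open>\<Delta> - x(\<Delta>)\<close> is strictly increasing for
  \<open>\<Delta> \<ge> 1\<close>, the gap is largest at \<open>\<Delta> = n - 1\<close> and only for the star. Edgeless graphs have gap
  \<open>0\<close>, which is the value of the bound at \<open>n = 2\<close>.
\<close>

section \<open>The maximum of a symmetric form\<close>

text \<open>A maximiser \<open>x\<close> of the form on the unit sphere exists by compactness, and
  the first variation there forces the eigenvalue equation with \<open>M\<close> the maximum. The
  index set is an arbitrary finite set so that vertices can serve as indices directly.\<close>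

lemma symmetric_form_max_eigenvalue:
  fixes a :: "'i \<Rightarrow> 'i \<Rightarrow> real"
  assumes fin: "finite I" and ne: "I \<noteq> {}"
    and sym: "\<And>i j. i \<in> I \<Longrightarrow> j \<in> I \<Longrightarrow> a i j = a j i"
  obtains M x where "\<exists>i\<in>I. x i \<noteq> 0"
    and "\<forall>i\<in>I. (\<Sum>j\<in>I. a i j * x j) = M * x i"
    and "\<forall>y. (\<Sum>i\<in>I. \<Sum>j\<in>I. a i j * y i * y j) \<le> M * (\<Sum>i\<in>I. (y i)\<^sup>2)"
proof -
  define q where "q y = (\<Sum>i\<in>I. \<Sum>j\<in>I. a i j * y i * y j)" for y :: "'i \<Rightarrow> real"
  \<comment> \<open>The unit sphere, with coordinates outside \<open>I\<close> pinned to 0. The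
    redundant bounds -1 and 1 make it a closed subset of a product of compact sets, so Tychonoff's
    theorem applies to functions on the whole type.\<close>
  define S where "S = {x. (\<Sum>i\<in>I. (x i)\<^sup>2) = 1} \<inter>
    PiE UNIV (\<lambda>i. if i \<in> I then {-1..1::real} else {0})"
  have "compactin (product_topology (\<lambda>_. euclidean) UNIV)
      (PiE UNIV (\<lambda>i. if i \<in> I then {-1..1::real} else {0}))"
    unfolding compactin_PiE by auto
  then have "compact (PiE UNIV (\<lambda>i. if i \<in> I then {-1..1::real} else {0}))"
    by (simp add: euclidean_product_topology)
  moreover have "closed {x :: 'i \<Rightarrow> real. (\<Sum>i\<in>I. (x i)\<^sup>2) = 1}"
    by (intro closed_Collect_eq continuous_intros continuous_on_product_coordinates)
  ultimately have "compact S"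
    unfolding S_def by (rule closed_Int_compact[rotated])
  moreover obtain i0 where "i0 \<in> I"
    using ne by blast
  then have "(\<lambda>i. if i = i0 then 1 else 0) \<in> S"
    using fin by (auto simp: S_def if_distrib[of "\<lambda>t. t\<^sup>2"] cong: if_cong)
  then have "S \<noteq> {}"
    by blast
  moreover have "continuous_on S q"
    unfolding q_def by (intro continuous_intros continuous_on_product_then_coordinatewise[OF continuous_on_id])
  ultimately obtain x where x: "x \<in> S" and max: "\<And>y. y \<in> S \<Longrightarrow> q y \<le> q x"
    by (metis continuous_attains_sup)
  have norm_x: "(\<Sum>i\<in>I. (x i)\<^sup>2) = 1"
    using x by (simp add: S_def)
  have bound: "q y \<le> q x * (\<Sum>i\<in>I. (y i)\<^sup>2)" for y
  proof (cases "(\<Sum>i\<in>I. (y i)\<^sup>2) = 0")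
    case True
    then have "\<forall>i\<in>I. y i = 0"
      using fin by (simp add: sum_nonneg_eq_0_iff)
    then have "q y = 0"
      by (simp add: q_def)
    with True show ?thesis by simp
  next
    case False
    define N where "N = (\<Sum>i\<in>I. (y i)\<^sup>2)"
    have N: "N > 0"
      using False by (simp add: N_def less_le sum_nonneg)
    define z where "z i = (if i \<in> I then y i / sqrt N else 0)" for i
    have z_norm: "(\<Sum>i\<in>I. (z i)\<^sup>2) = 1"
      using N by (simp add: z_def power_divide flip: sum_divide_distrib) (simp add: N_def)
    have "\<bar>z i\<bar> \<le> 1" if "i \<in> I" for i
    proof -
      have "(z i)\<^sup>2 \<le> (\<Sum>i\<in>I. (z i)\<^sup>2)"
        using fin that by (intro member_le_sum) auto
      then show ?thesis
        by (simp add: z_norm abs_square_le_1)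
    qed
    then have "z i \<in> (if i \<in> I then {-1..1} else {0})" for i
      by (cases "i \<in> I") (simp_all add: abs_le_iff minus_le_iff, simp add: z_def)
    then have "z \<in> S"
      using z_norm unfolding S_def by blast
    then have "q z \<le> q x"
      by (rule max)
    moreover have "q z = (\<Sum>i\<in>I. \<Sum>j\<in>I. a i j * y i * y j / N)"
      unfolding q_def using N by (intro sum.cong refl) (simp add: z_def)
    then have "q z = q y / N"
      by (simp add: q_def sum_divide_distrib)
    ultimately show ?thesis
      using N by (simp add: N_def field_simps)
  qed
  \<comment> \<open>The residual of the eigenvalue equation at \<open>x\<close>; the aim is that its
    squared norm \<open>c\<close> vanishes.\<close>
  define r where "r i = (\<Sum>j\<in>I. a i j * x j) - q x * x i" for i
  define c where "c = (\<Sum>i\<in>I. (r i)\<^sup>2)"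
  define K where "K = q x * c - q r"
  have "K \<ge> 0"
    using bound[of r] by (simp add: K_def c_def)
  have r_form: "(\<Sum>i\<in>I. r i * (\<Sum>j\<in>I. a i j * x j)) = c + q x * (\<Sum>i\<in>I. r i * x i)"
  proof -
    have "(\<Sum>i\<in>I. r i * (\<Sum>j\<in>I. a i j * x j)) = (\<Sum>i\<in>I. (r i)\<^sup>2 + q x * (r i * x i))"
      by (intro sum.cong refl) (simp add: r_def power2_eq_square algebra_simps)
    then show ?thesis
      by (simp add: c_def sum.distrib sum_distrib_left)
  qed
  \<comment> \<open>This is \<open>bound\<close> at \<open>x + t r\<close>: the constant terms and
    those with the inner product of \<open>r\<close> and \<open>x\<close> cancel, which leaves a
    term linear in \<open>t\<close> against a quadratic one.\<close>
  have variation: "2 * t * c \<le> t\<^sup>2 * K" for t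
  proof -
    have swap: "(\<Sum>i\<in>I. \<Sum>j\<in>I. a i j * x i * r j) = (\<Sum>i\<in>I. r i * (\<Sum>j\<in>I. a i j * x j))"
      by (subst sum.swap) (auto intro!: sum.cong simp: sum_distrib_left sym)
    have "q (\<lambda>i. x i + t * r i) =
        (\<Sum>i\<in>I. \<Sum>j\<in>I. a i j * x i * x j + t * (a i j * x i * r j) + t * (r i * (a i j * x j))
          + t\<^sup>2 * (a i j * r i * r j))"
      unfolding q_def by (intro sum.cong refl) (simp add: algebra_simps power2_eq_square)
    also have "\<dots> = q x + t * (\<Sum>i\<in>I. \<Sum>j\<in>I. a i j * x i * r j)
        + t * (\<Sum>i\<in>I. r i * (\<Sum>j\<in>I. a i j * x j)) + t\<^sup>2 * q r"
      by (simp add: q_def sum.distrib sum_distrib_left)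
    also have "\<dots> = q x + 2 * t * (c + q x * (\<Sum>i\<in>I. r i * x i)) + t\<^sup>2 * q r"
      unfolding swap r_form by simp
    finally have "q (\<lambda>i. x i + t * r i) = \<dots>" .
    moreover have "(\<Sum>i\<in>I. (x i + t * r i)\<^sup>2) = 1 + 2 * t * (\<Sum>i\<in>I. r i * x i) + t\<^sup>2 * c"
    proof -
      have "(\<Sum>i\<in>I. (x i + t * r i)\<^sup>2) =
          (\<Sum>i\<in>I. (x i)\<^sup>2 + 2 * t * (r i * x i) + t\<^sup>2 * (r i)\<^sup>2)"
        by (intro sum.cong refl) (simp add: algebra_simps power2_eq_square)
      then show ?thesis
        by (simp add: sum.distrib norm_x c_def sum_distrib_left)
    qed
    ultimately show ?thesis
      using bound[of "\<lambda>i. x i + t * r i"] by (simp add: K_def algebra_simps)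
  qed
  \<comment> \<open>This choice turns the variation inequality into
    \<open>2 * t\<^sup>2 * (K + 1) \<le> t\<^sup>2 * K\<close>, which forces \<open>t = 0\<close>.
    Dividing by \<open>K + 1\<close> instead of \<open>K\<close> covers
    \<open>K = 0\<close>.\<close>
  define t where "t = c / (K + 1)"
  have c_t: "c = t * (K + 1)"
    using \<open>K \<ge> 0\<close> by (simp add: t_def)
  have "t\<^sup>2 * (K + 2) \<le> 0"
    using variation[of t] unfolding c_t by (simp add: algebra_simps power2_eq_square)
  then have "t = 0"
    using \<open>K \<ge> 0\<close> by (simp add: mult_le_0_iff)
  then have "c = 0"
    using c_t by simp
  then have "\<forall>i\<in>I. r i = 0"
    using fin by (simp add: c_def sum_nonneg_eq_0_iff)
  moreover have "\<exists>i\<in>I. x i \<noteq> 0"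
  proof (rule ccontr)
    assume "\<not> ?thesis"
    then have "(\<Sum>i\<in>I. (x i)\<^sup>2) = 0" by simp
    with norm_x show False by simp
  qed
  ultimately show thesis
    using bound that[of x "q x"] by (auto simp: r_def q_def)
qed

section \<open>The largest eigenvalue of a star\<close>

text \<open>The argument \<open>m\<close> counts the leaves, so the star has \<open>m + 1\<close> vertices.\<close>

definition star_rho :: "real \<Rightarrow> real \<Rightarrow> real" where
  "star_rho \<alpha> m = (\<alpha> * (m + 1) + sqrt (\<alpha>\<^sup>2 * (m + 1)\<^sup>2 + 4 * (1 - 2 * \<alpha>) * m)) / 2"

text \<open>The right-hand side is the discriminant of \<open>(x - \<alpha> * m) * (x - \<alpha>) =
  (1 - \<alpha>)\<^sup>2 * m\<close> and is visibly nonnegative for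
  \<open>m \<ge> 0\<close>.\<close>

lemma star_rho_discriminant:
  fixes \<alpha> m :: real
  shows "\<alpha>\<^sup>2 * (m + 1)\<^sup>2 + 4 * (1 - 2 * \<alpha>) * m = (\<alpha> * (m - 1))\<^sup>2 + 4 * m * (1 - \<alpha>)\<^sup>2"
  by (simp add: power2_eq_square algebra_simps)

text \<open>The quadratic arises by eliminating the leaf value from the eigenvalue equations at the
  centre and at a leaf, for a vector constant on the leaves.\<close>

lemma star_rho_root:
  assumes "m \<ge> 0"
  shows "(star_rho \<alpha> m - \<alpha> * m) * (star_rho \<alpha> m - \<alpha>) = (1 - \<alpha>)\<^sup>2 * m"
proof -
  define s where "s = sqrt (\<alpha>\<^sup>2 * (m + 1)\<^sup>2 + 4 * (1 - 2 * \<alpha>) * m)"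
  have s2: "s\<^sup>2 = (\<alpha> * (m - 1))\<^sup>2 + 4 * m * (1 - \<alpha>)\<^sup>2"
    unfolding s_def star_rho_discriminant using assms by simp
  have "4 * ((star_rho \<alpha> m - \<alpha> * m) * (star_rho \<alpha> m - \<alpha>)) = s\<^sup>2 - (\<alpha> * (m - 1))\<^sup>2"
    unfolding star_rho_def s_def[symmetric] by (simp add: field_simps power2_eq_square)
  then show ?thesis
    unfolding s2 by simp
qed

lemma star_rho_greater:
  assumes "m \<ge> 1" "\<alpha> < 1"
  shows "star_rho \<alpha> m > \<alpha> * m"
proof -
  have "(\<alpha> * (m - 1))\<^sup>2 < (\<alpha> * (m - 1))\<^sup>2 + 4 * m * (1 - \<alpha>)\<^sup>2"
    using assms by simp
  then have "\<alpha> * (m - 1) < sqrt (\<alpha>\<^sup>2 * (m + 1)\<^sup>2 + 4 * (1 - 2 * \<alpha>) * m)"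
    unfolding star_rho_discriminant by (rule real_less_rsqrt)
  then show ?thesis
    by (simp add: star_rho_def field_simps)
qed

lemma root_le_star_rho:
  assumes "(k - \<alpha> * m) * (k - \<alpha>) = (1 - \<alpha>)\<^sup>2 * m"
  shows "k \<le> star_rho \<alpha> m"
proof -
  have "(2 * k - \<alpha> * (m + 1))\<^sup>2 = (\<alpha> * (m - 1))\<^sup>2 + 4 * ((k - \<alpha> * m) * (k - \<alpha>))"
    by (simp add: power2_eq_square algebra_simps)
  then have "2 * k - \<alpha> * (m + 1) \<le> sqrt (\<alpha>\<^sup>2 * (m + 1)\<^sup>2 + 4 * (1 - 2 * \<alpha>) * m)"
    unfolding star_rho_discriminant assms by (intro real_le_rsqrt) simp
  then show ?thesis
    by (simp add: star_rho_def)
qed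

text \<open>The first hypothesis places \<open>k\<close> outside the interval between the two roots,
  the second to the right of its midpoint, hence beyond the larger root.\<close>

lemma star_rho_less:
  assumes "(k - \<alpha> * m) * (k - \<alpha>) > (1 - \<alpha>)\<^sup>2 * m" and "2 * k \<ge> \<alpha> * (m + 1)"
  shows "star_rho \<alpha> m < k"
proof -
  have "(2 * k - \<alpha> * (m + 1))\<^sup>2 = (\<alpha> * (m - 1))\<^sup>2 + 4 * ((k - \<alpha> * m) * (k - \<alpha>))"
    by (simp add: power2_eq_square algebra_simps)
  then have "sqrt (\<alpha>\<^sup>2 * (m + 1)\<^sup>2 + 4 * (1 - 2 * \<alpha>) * m) < 2 * k - \<alpha> * (m + 1)"
    unfolding star_rho_discriminant using assms by (intro real_less_lsqrt) (simp_all add: mult.commute)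
  then show ?thesis
    by (simp add: star_rho_def)
qed

text \<open>With \<open>t = m' - m\<close> the claim is
  \<open>star_rho \<alpha> m' < star_rho \<alpha> m + t\<close>, obtained by testing the quadratic
  for \<open>m'\<close> at the right-hand side. A step of at least 1 suffices, as degrees are
  integers.\<close>

lemma star_gap_strict_mono:
  assumes \<alpha>: "0 \<le> \<alpha>" "\<alpha> < 1" and m: "1 \<le> m" "m + 1 \<le> m'"
  shows "m - star_rho \<alpha> m < m' - star_rho \<alpha> m'"
proof -
  define x where "x = star_rho \<alpha> m"
  define t where "t = m' - m"
  have t: "t \<ge> 1" and m': "m' = m + t"
    using m by (simp_all add: t_def)
  have root: "(x - \<alpha> * m) * (x - \<alpha>) = (1 - \<alpha>)\<^sup>2 * m"
    unfolding x_def using m by (intro star_rho_root) simp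
  have x: "x > \<alpha> * m"
    unfolding x_def using m \<alpha> by (intro star_rho_greater)
  moreover have "\<alpha> * m \<ge> 0"
    using \<alpha> m by simp
  ultimately have x0: "x > 0" by linarith
  then have "x \<le> (2 - \<alpha>) * x"
    using \<alpha> by simp
  moreover have "(t - 1) * (1 - \<alpha>) \<ge> 0"
    using t \<alpha> by simp
  \<comment> \<open>This product is the amount by which the difference of the two sides of the
    quadratic grows in passing from \<open>m\<close> and \<open>x\<close> to \<open>m'\<close> and
    \<open>x + t\<close>; that difference vanishes at the start.\<close>
  ultimately have pos: "t * ((2 - \<alpha>) * x - \<alpha> * m + (t - 1) * (1 - \<alpha>)) > 0"
    using t x by (intro mult_pos_pos) linarith+
  have "(x + t - \<alpha> * m') * (x + t - \<alpha>) - (1 - \<alpha>)\<^sup>2 * m' =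
      (x - \<alpha> * m) * (x - \<alpha>) - (1 - \<alpha>)\<^sup>2 * m + t * ((2 - \<alpha>) * x - \<alpha> * m + (t - 1) * (1 - \<alpha>))"
    unfolding m' by (simp add: power2_eq_square algebra_simps)
  then have "(x + t - \<alpha> * m') * (x + t - \<alpha>) > (1 - \<alpha>)\<^sup>2 * m'"
    using root pos by simp
  moreover have "2 * (x + t) \<ge> \<alpha> * (m' + 1)"
  proof -
    have "\<alpha> * t \<le> t"
      using \<alpha> t by (intro mult_left_le_one_le) simp_all
    then have "\<alpha> * m + \<alpha> * t + \<alpha> \<le> x + t + t"
      using x t \<alpha> by (intro add_mono) simp_all
    then show ?thesis
      using x0 by (simp add: m' algebra_simps)
  qed
  ultimately have "star_rho \<alpha> m' < x + t"
    by (rule star_rho_less)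
  then show ?thesis
    by (simp add: x_def m')
qed

text \<open>A single edge has largest eigenvalue 1 for every such \<alpha>. This anchors the
  comparison with edgeless graphs, whose gap is also 0.\<close>

lemma star_gap_1:
  assumes "\<alpha> \<le> 1"
  shows "1 - star_rho \<alpha> 1 = 0"
proof -
  have "sqrt (4 * (1 - \<alpha>)\<^sup>2) = 2 * (1 - \<alpha>)"
    using assms by (simp add: real_sqrt_mult)
  then show ?thesis
    by (simp only: star_rho_def star_rho_discriminant) simp
qed

section \<open>Stars up to isomorphism\<close>

lemma (in nomulti_digraph) out_degree_eq_card_adj:
  "out_degree G v = card {w. v \<rightarrow>\<^bsub>G\<^esub> w}"
proof -
  have "{w. v \<rightarrow>\<^bsub>G\<^esub> w} = head G ` out_arcs G v"
    by (auto simp: arcs_ends_conv image_iff)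
  moreover have "inj_on (head G) (out_arcs G v)"
    by (auto intro!: inj_onI no_multi_arcs simp: arc_to_ends_def)
  ultimately show ?thesis
    by (simp add: out_degree_def card_image)
qed

text \<open>Trades isomorphisms, which also carry maps on arcs, for a condition on
  \<open>arcs_ends\<close>. The centre \<open>u\<close> is the vertex sent to 0.\<close>

lemma (in graph) digraph_iso_star_iff:
  assumes "card (verts G) = n" "n \<ge> 1"
  shows "digraph_iso G (with_proj (star n)) \<longleftrightarrow>
    (\<exists>u\<in>verts G. arcs_ends G = {u} \<times> (verts G - {u}) \<union> (verts G - {u}) \<times> {u})"
    (is "?L \<longleftrightarrow> ?R")
proof
  assume ?L
  then obtain h where h: "digraph_isomorphism h" and eq: "with_proj (star n) = app_iso h G"
    by (auto simp: digraph_iso_def)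
  let ?f = "iso_verts h"
  have inj: "inj_on ?f (verts G)"
    using h by (simp add: digraph_isomorphism_def)
  have verts: "?f ` verts G = {0..<n}"
    using arg_cong[OF eq, of verts] by (simp add: star_def)
  \<comment> \<open>Arcs of \<open>with_proj (star n)\<close> are pairs with \<open>fst\<close> as
    tail and \<open>snd\<close> as head, so the arc map is determined by the images of the end
    points.\<close>
  have arcs_ends: "map_prod ?f ?f ` arcs_ends G = {0} \<times> {1..<n} \<union> {1..<n} \<times> {0}"
  proof -
    have "tail (with_proj (star n)) = iso_tail h" "head (with_proj (star n)) = iso_head h"
      unfolding eq by simp_all
    then have "iso_tail h = fst" "iso_head h = snd"
      by simp_all
    then have "iso_arcs h e = map_prod ?f ?f (arc_to_ends G e)" if "e \<in> arcs G" for e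
      using h that by (simp add: digraph_isomorphism_def arc_to_ends_def prod_eq_iff)
    then have "map_prod ?f ?f ` arcs_ends G = iso_arcs h ` arcs G"
      by (auto simp: arcs_ends_def image_image)
    also have "\<dots> = parcs (star n)"
      using arg_cong[OF eq, of arcs] by simp
    finally show ?thesis
      by (simp add: star_def)
  qed
  have arc_iff: "v \<rightarrow>\<^bsub>G\<^esub> w \<longleftrightarrow> (?f v, ?f w) \<in> {0} \<times> {1..<n} \<union> {1..<n} \<times> {0}"
    if "v \<in> verts G" "w \<in> verts G" for v w
    unfolding arcs_ends[symmetric] using that inj
    by (auto simp: image_iff dest: adj_in_verts inj_onD intro!: bexI[of _ "(v, w)"])
       (metis adj_in_verts inj_onD)
  have "0 \<in> ?f ` verts G"
    using verts assms(2) by simp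
  then obtain u where u: "u \<in> verts G" "?f u = 0"
    by auto
  have leaf: "?f v \<in> {1..<n} \<longleftrightarrow> v \<noteq> u" if "v \<in> verts G" for v
  proof -
    have "?f v \<in> {0..<n}"
      using verts that by blast
    then show ?thesis
      using inj_onD[OF inj, of v u] u that by (auto simp: Suc_le_eq)
  qed
  have zero: "?f v = 0 \<longleftrightarrow> v = u" if "v \<in> verts G" for v
    using inj_onD[OF inj, of v u] u that by auto
  have "v \<rightarrow>\<^bsub>G\<^esub> w \<longleftrightarrow> (v, w) \<in> {u} \<times> (verts G - {u}) \<union> (verts G - {u}) \<times> {u}" for v w
  proof (cases "v \<in> verts G \<and> w \<in> verts G")
    case True
    then show ?thesis
      using arc_iff[of v w] leaf zero by auto
  next
    case False
    then show ?thesis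
      using u(1) by (auto dest: adj_in_verts)
  qed
  then show ?R
    using u(1) by (intro bexI[of _ u]) auto
next
  assume ?R
  then obtain u where u: "u \<in> verts G"
    and ends: "arcs_ends G = {u} \<times> (verts G - {u}) \<union> (verts G - {u}) \<times> {u}"
    by blast
  have "card (verts G - {u}) = card {1..<n}"
    using assms u by simp
  then obtain g where g: "bij_betw g (verts G - {u}) {1..<n}"
    using finite_same_card_bij[of "verts G - {u}" "{1..<n}"] by auto
  define f where "f v = (if v = u then 0 else g v)" for v
  have f: "f u = 0" "f ` (verts G - {u}) = {1..<n}"
    using g by (auto simp: f_def bij_betw_def)
  have verts: "f ` verts G = {0..<n}"
  proof -
    have "f ` verts G = insert (f u) (f ` (verts G - {u}))"
      using u by blast
    also have "\<dots> = {0..<n}"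
      unfolding f using assms(2) by auto
    finally show ?thesis .
  qed
  then have inj: "inj_on f (verts G)"
    using assms(1) by (intro eq_card_imp_inj_on) simp_all
  \<comment> \<open>Each arc goes to the pair of images of its ends; this is injective because there
    are no parallel arcs.\<close>
  define h where "h = \<lparr>iso_verts = f, iso_arcs = map_prod f f \<circ> arc_to_ends G,
    iso_head = snd, iso_tail = fst\<rparr>"
  have "inj_on (map_prod f f \<circ> arc_to_ends G) (arcs G)"
  proof (rule comp_inj_on[OF inj_on_arc_to_ends])
    have "inj_on (map_prod f f) (verts G \<times> verts G)"
      using inj by (intro map_prod_inj_on)
    then show "inj_on (map_prod f f) (arc_to_ends G ` arcs G)"
      by (rule inj_on_subset) (auto simp: arc_to_ends_def)
  qed
  then have "digraph_isomorphism h"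
    using inj wf_digraph by (simp add: digraph_isomorphism_def h_def arc_to_ends_def)
  moreover have "with_proj (star n) = app_iso h G"
  proof -
    have "(map_prod f f \<circ> arc_to_ends G) ` arcs G = map_prod f f ` arcs_ends G"
      by (simp add: arcs_ends_def image_comp)
    also have "\<dots> = {f u} \<times> f ` (verts G - {u}) \<union> f ` (verts G - {u}) \<times> {f u}"
      unfolding ends image_Un map_prod_surj_on[OF refl refl] by simp
    finally show ?thesis
      by (simp add: with_proj_def star_def app_iso_def h_def verts f)
  qed
  ultimately show ?L
    by (auto simp: digraph_iso_def)
qed

section \<open>The matrix as an operator on vertex functions\<close>

text \<open>Indexing by vertices instead of positions frees the spectral arguments from the ordering
  \<open>vs\<close>.\<close>

definition A_alpha_entry :: "real \<Rightarrow> ('a, 'b) pre_digraph \<Rightarrow> 'a \<Rightarrow> 'a \<Rightarrow> real" where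
  "A_alpha_entry \<alpha> G v w = \<alpha> * (if v = w then real (out_degree G v) else 0)
     + (1 - \<alpha>) * (if v \<rightarrow>\<^bsub>G\<^esub> w then 1 else 0)"

lemma A_alpha_carrier: "A_alpha \<alpha> G vs \<in> carrier_mat (length vs) (length vs)"
  by (auto simp: A_alpha_def degree_mat_def adjacency_mat_def)

lemma A_alpha_index:
  assumes "distinct vs" "i < length vs" "j < length vs"
  shows "A_alpha \<alpha> G vs $$ (i, j) = A_alpha_entry \<alpha> G (vs ! i) (vs ! j)"
  using assms
  by (simp add: A_alpha_def degree_mat_def adjacency_mat_def A_alpha_entry_def nth_eq_iff_index_eq)

text \<open>Eigenvectors are carried across the bijection from positions in \<open>vs\<close> to
  vertices.\<close>

lemma eigenvalue_A_alpha_iff: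
  assumes ord: "vertex_ordering G vs"
  shows "eigenvalue (A_alpha \<alpha> G vs) k \<longleftrightarrow>
    (\<exists>z. (\<exists>v\<in>verts G. z v \<noteq> 0) \<and>
         (\<forall>v\<in>verts G. (\<Sum>w\<in>verts G. A_alpha_entry \<alpha> G v w * z w) = k * z v))"
    (is "?L \<longleftrightarrow> ?R")
proof -
  let ?A = "A_alpha \<alpha> G vs" and ?n = "length vs"
  have dist: "distinct vs" and set: "set vs = verts G"
    using ord by (simp_all add: vertex_ordering_def)
  have bij: "bij_betw ((!) vs) {0..<?n} (verts G)"
    using dist set by (intro bij_betw_nth) (auto simp: atLeast0LessThan)
  have row: "(?A *\<^sub>v x) $ i = (\<Sum>j = 0..<?n. A_alpha_entry \<alpha> G (vs ! i) (vs ! j) * x $ j)"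
    if "x \<in> carrier_vec ?n" "i < ?n" for x i
    using that A_alpha_carrier[of \<alpha> G vs]
    by (auto simp: scalar_prod_def A_alpha_index[OF dist] intro!: sum.cong)
  show ?thesis
  proof
    assume ?L
    then obtain x where x: "x \<in> carrier_vec ?n" "x \<noteq> 0\<^sub>v ?n" "?A *\<^sub>v x = k \<cdot>\<^sub>v x"
      using A_alpha_carrier[of \<alpha> G vs] by (auto simp: eigenvalue_def eigenvector_def)
    define z where "z v = x $ (the_inv_into {0..<?n} ((!) vs) v)" for v
    have z: "z (vs ! i) = x $ i" if "i < ?n" for i
      using that bij by (simp add: z_def the_inv_into_f_f bij_betw_def)
    obtain i where "i < ?n" "x $ i \<noteq> 0"
      using x(1,2) by (metis carrier_vecD eq_vecI index_zero_vec)
    then have "\<exists>v\<in>verts G. z v \<noteq> 0"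
      using z set by (metis nth_mem)
    moreover have "(\<Sum>w\<in>verts G. A_alpha_entry \<alpha> G v w * z w) = k * z v" if v: "v \<in> verts G" for v
    proof -
      obtain i where i: "i < ?n" "v = vs ! i"
        using v set by (metis in_set_conv_nth)
      have "(\<Sum>w\<in>verts G. A_alpha_entry \<alpha> G v w * z w) =
          (\<Sum>j = 0..<?n. A_alpha_entry \<alpha> G v (vs ! j) * z (vs ! j))"
        by (rule sum.reindex_bij_betw[OF bij, symmetric])
      also have "\<dots> = (?A *\<^sub>v x) $ i"
        using x(1) i by (subst row) (auto simp: z)
      also have "\<dots> = k * z v"
        using x i by (simp add: z)
      finally show ?thesis .
    qed
    ultimately show ?R by blast
  next
    assume ?R
    then obtain z where nz: "\<exists>v\<in>verts G. z v \<noteq> 0"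
      and z: "\<And>v. v \<in> verts G \<Longrightarrow> (\<Sum>w\<in>verts G. A_alpha_entry \<alpha> G v w * z w) = k * z v"
      by blast
    define x where "x = vec ?n (\<lambda>i. z (vs ! i))"
    have x: "x \<in> carrier_vec ?n"
      by (simp add: x_def)
    obtain i where "i < ?n" "z (vs ! i) \<noteq> 0"
      using nz set by (metis in_set_conv_nth)
    then have "x \<noteq> 0\<^sub>v ?n"
      by (metis x_def index_vec index_zero_vec(1))
    moreover have "?A *\<^sub>v x = k \<cdot>\<^sub>v x"
    proof (rule eq_vecI)
      fix i assume "i < dim_vec (k \<cdot>\<^sub>v x)"
      then have i: "i < ?n" by (simp add: x_def)
      have "(?A *\<^sub>v x) $ i = (\<Sum>j = 0..<?n. A_alpha_entry \<alpha> G (vs ! i) (vs ! j) * z (vs ! j))"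
        using row[OF x i] by (simp add: x_def)
      also have "\<dots> = (\<Sum>w\<in>verts G. A_alpha_entry \<alpha> G (vs ! i) w * z w)"
        by (rule sum.reindex_bij_betw[OF bij])
      also have "\<dots> = k * z (vs ! i)"
        using i set by (simp add: z[of "vs ! i"] nth_mem[of i vs, unfolded set])
      finally show "(?A *\<^sub>v x) $ i = (k \<cdot>\<^sub>v x) $ i"
        using i by (simp add: x_def)
    qed (use A_alpha_carrier[of \<alpha> G vs] in \<open>auto simp: x_def\<close>)
    ultimately show ?L
      using x A_alpha_carrier[of \<alpha> G vs] by (auto simp: eigenvalue_def eigenvector_def)
  qed
qed

lemma finite_spectrum_A_alpha: "finite (spectrum (A_alpha \<alpha> G vs))"
  using A_alpha_carrier by (rule card_finite_spectrum(1))

context graph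
begin

text \<open>The diagonal term is spread over the neighbours: the degree of \<open>v\<close> counts
  the summands \<open>\<alpha> * z v\<close>.\<close>

lemma sum_A_alpha_entry:
  assumes "v \<in> verts G"
  shows "(\<Sum>w\<in>verts G. A_alpha_entry \<alpha> G v w * z w) =
    (\<Sum>w | v \<rightarrow>\<^bsub>G\<^esub> w. \<alpha> * z v + (1 - \<alpha>) * z w)"
proof -
  have adj: "verts G \<inter> {w. v \<rightarrow>\<^bsub>G\<^esub> w} = {w. v \<rightarrow>\<^bsub>G\<^esub> w}"
    by (auto dest: adj_in_verts)
  have "(\<Sum>w\<in>verts G. A_alpha_entry \<alpha> G v w * z w) =
      (\<Sum>w\<in>verts G. (if w = v then \<alpha> * out_degree G v * z v else 0) +
        (if w \<in> {w. v \<rightarrow>\<^bsub>G\<^esub> w} then (1 - \<alpha>) * z w else 0))"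
    by (intro sum.cong) (auto simp: A_alpha_entry_def algebra_simps)
  also have "\<dots> = \<alpha> * out_degree G v * z v + (\<Sum>w | v \<rightarrow>\<^bsub>G\<^esub> w. (1 - \<alpha>) * z w)"
    using assms by (simp only: sum.distrib sum.delta finite_verts sum.inter_restrict[symmetric] adj) simp
  finally show ?thesis
    by (simp add: sum.distrib out_degree_eq_card_adj)
qed

lemma A_alpha_entry_sym: "A_alpha_entry \<alpha> G v w = A_alpha_entry \<alpha> G w v"
  using arcs_ends_symmetric[OF sym_arcs] by (auto simp: A_alpha_entry_def)

text \<open>Each edge contributes both of its arcs. For \<open>0 \<le> \<alpha> \<le> 1\<close> and
  nonnegative \<open>y\<close> every summand is nonnegative, so restricting to a subgraph cannot
  increase the form.\<close>

lemma quadratic_form_A_alpha: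
  "(\<Sum>v\<in>verts G. \<Sum>w\<in>verts G. A_alpha_entry \<alpha> G v w * y v * y w) =
    (\<Sum>(v, w)\<in>arcs_ends G. \<alpha> * (y v)\<^sup>2 + (1 - \<alpha>) * y v * y w)"
proof -
  have "(\<Sum>v\<in>verts G. \<Sum>w\<in>verts G. A_alpha_entry \<alpha> G v w * y v * y w) =
      (\<Sum>v\<in>verts G. y v * (\<Sum>w\<in>verts G. A_alpha_entry \<alpha> G v w * y w))"
    by (simp add: sum_distrib_left mult_ac)
  also have "\<dots> = (\<Sum>v\<in>verts G. \<Sum>w | v \<rightarrow>\<^bsub>G\<^esub> w. \<alpha> * (y v)\<^sup>2 + (1 - \<alpha>) * y v * y w)"
    by (intro sum.cong refl)
       (simp add: sum_A_alpha_entry, simp add: sum_distrib_left algebra_simps power2_eq_square)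
  also have "\<dots> = (\<Sum>(v, w)\<in>Sigma (verts G) (\<lambda>v. {w. v \<rightarrow>\<^bsub>G\<^esub> w}).
      \<alpha> * (y v)\<^sup>2 + (1 - \<alpha>) * y v * y w)"
    by (rule sum.Sigma) (auto intro: finite_subset[OF _ finite_verts] dest: adj_in_verts)
  also have "Sigma (verts G) (\<lambda>v. {w. v \<rightarrow>\<^bsub>G\<^esub> w}) = arcs_ends G"
    by (auto dest: adj_in_verts)
  finally show ?thesis .
qed

text \<open>The maximum \<open>M\<close> of the form is an eigenvalue, so the spectrum is nonempty
  and its \<open>Max\<close> is a genuine element that is at least \<open>M\<close>.\<close>

lemma
  assumes "vertex_ordering G vs" "verts G \<noteq> {}"
  shows eigenvalue_rho_alpha: "eigenvalue (A_alpha \<alpha> G vs) (rho_alpha \<alpha> G vs)"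
    and rayleigh_rho_alpha: "(\<Sum>(v, w)\<in>arcs_ends G. \<alpha> * (y v)\<^sup>2 + (1 - \<alpha>) * y v * y w)
      \<le> rho_alpha \<alpha> G vs * (\<Sum>v\<in>verts G. (y v)\<^sup>2)"
proof -
  obtain M x where Mx: "\<exists>v\<in>verts G. x v \<noteq> 0"
      "\<forall>v\<in>verts G. (\<Sum>w\<in>verts G. A_alpha_entry \<alpha> G v w * x w) = M * x v"
    and bound: "\<forall>y. (\<Sum>v\<in>verts G. \<Sum>w\<in>verts G. A_alpha_entry \<alpha> G v w * y v * y w)
      \<le> M * (\<Sum>v\<in>verts G. (y v)\<^sup>2)"
    by (rule symmetric_form_max_eigenvalue[where a = "A_alpha_entry \<alpha> G",
          OF finite_verts assms(2) A_alpha_entry_sym])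
  have M: "M \<in> spectrum (A_alpha \<alpha> G vs)"
    using Mx unfolding spectrum_def mem_Collect_eq eigenvalue_A_alpha_iff[OF assms(1)] by blast
  then have "rho_alpha \<alpha> G vs \<in> spectrum (A_alpha \<alpha> G vs)"
    unfolding rho_alpha_def by (intro Max_in finite_spectrum_A_alpha) auto
  then show "eigenvalue (A_alpha \<alpha> G vs) (rho_alpha \<alpha> G vs)"
    by (simp add: spectrum_def)
  have "M \<le> rho_alpha \<alpha> G vs"
    unfolding rho_alpha_def using M by (intro Max_ge finite_spectrum_A_alpha)
  then have "M * (\<Sum>v\<in>verts G. (y v)\<^sup>2) \<le> rho_alpha \<alpha> G vs * (\<Sum>v\<in>verts G. (y v)\<^sup>2)"
    by (intro mult_right_mono sum_nonneg) simp_all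
  then show "(\<Sum>(v, w)\<in>arcs_ends G. \<alpha> * (y v)\<^sup>2 + (1 - \<alpha>) * y v * y w)
      \<le> rho_alpha \<alpha> G vs * (\<Sum>v\<in>verts G. (y v)\<^sup>2)"
    using bound[rule_format, of y] unfolding quadratic_form_A_alpha by linarith
qed

section \<open>Comparison with the star\<close>

lemma rho_alpha_ge_star_rho:
  assumes ord: "vertex_ordering G vs" and \<alpha>: "0 \<le> \<alpha>" "\<alpha> < 1"
    and u: "u \<in> verts G" and deg: "out_degree G u \<ge> 1"
  shows "star_rho \<alpha> (out_degree G u) \<le> rho_alpha \<alpha> G vs"
    and "{w. u \<rightarrow>\<^bsub>G\<^esub> w} = verts G - {u} \<Longrightarrow>
      arcs_ends G \<noteq> {u} \<times> (verts G - {u}) \<union> (verts G - {u}) \<times> {u} \<Longrightarrow>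
      star_rho \<alpha> (out_degree G u) < rho_alpha \<alpha> G vs"
proof -
  define N where "N = {w. u \<rightarrow>\<^bsub>G\<^esub> w}"
  define D where "D = real (out_degree G u)"
  define x where "x = star_rho \<alpha> D"
  \<comment> \<open>The leaf equation \<open>(x - \<alpha>) * z v = (1 - \<alpha>) * z u\<close>
    dictates the values \<open>a\<close> at the centre and \<open>b\<close> at the
    neighbours.\<close>
  define a where "a = x - \<alpha>"
  define b where "b = 1 - \<alpha>"
  define y where "y v = (if v = u then a else if v \<in> N then b else 0)" for v
  define f where "f = (\<lambda>(v, w). \<alpha> * (y v)\<^sup>2 + (1 - \<alpha>) * y v * y w)"
  define F where "F = {u} \<times> N \<union> N \<times> {u}"
  have D: "D \<ge> 1" "D = real (card N)"
    using deg by (simp_all add: D_def N_def out_degree_eq_card_adj)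
  have N: "N \<subseteq> verts G" "u \<notin> N"
    by (auto simp: N_def dest: adj_in_verts adj_not_same)
  then have finN: "finite N"
    by (auto intro: finite_subset)
  have "\<alpha> * 1 \<le> \<alpha> * D"
    using D \<alpha> by (intro mult_left_mono) simp_all
  moreover have "x > \<alpha> * D"
    unfolding x_def using D \<alpha> by (intro star_rho_greater)
  ultimately have a: "a > 0"
    by (simp add: a_def)
  have b: "b > 0"
    using \<alpha> by (simp add: b_def)
  have y_nonneg: "y v \<ge> 0" for v
    using a b by (simp add: y_def)
  have f_nonneg: "f e \<ge> 0" for e
    using \<alpha> y_nonneg by (cases e) (simp add: f_def)
  have F: "F \<subseteq> arcs_ends G"
    using arcs_ends_symmetric[OF sym_arcs] by (auto simp: F_def N_def)
  have fin: "finite (arcs_ends G)"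
    by (simp add: arcs_ends_def)
  have root: "(x - \<alpha> * D) * a = (1 - \<alpha>)\<^sup>2 * D"
    unfolding x_def a_def using D by (intro star_rho_root) simp
  have "sum f F = (\<Sum>e\<in>{u} \<times> N. f e) + (\<Sum>e\<in>N \<times> {u}. f e)"
    unfolding F_def using finN N(2) by (intro sum.union_disjoint) auto
  also have "(\<Sum>e\<in>{u} \<times> N. f e) = (\<Sum>w\<in>N. f (u, w))"
    by (simp add: sum.cartesian_product')
  also have "\<dots> = (\<Sum>w\<in>N. \<alpha> * a\<^sup>2 + (1 - \<alpha>) * a * b)"
    using N(2) by (intro sum.cong) (auto simp: f_def y_def)
  also have "(\<Sum>e\<in>N \<times> {u}. f e) = (\<Sum>w\<in>N. f (w, u))"
    by (simp add: sum.cartesian_product')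
  also have "\<dots> = (\<Sum>w\<in>N. \<alpha> * b\<^sup>2 + (1 - \<alpha>) * b * a)"
    using N(2) by (intro sum.cong) (auto simp: f_def y_def)
  finally have "sum f F = D * (\<alpha> * a\<^sup>2 + (1 - \<alpha>) * a * b) + D * (\<alpha> * b\<^sup>2 + (1 - \<alpha>) * b * a)"
    by (simp add: D(2))
  also have "\<dots> = a * (\<alpha> * D * a + (1 - \<alpha>)\<^sup>2 * D) + D * b\<^sup>2 * x"
    by (simp add: b_def a_def power2_eq_square algebra_simps)
  \<comment> \<open>Replacing \<open>(1 - \<alpha>)\<^sup>2 * D\<close> by
    \<open>(x - \<alpha> * D) * a\<close> cancels the \<open>\<alpha> * D\<close> terms: on the star
    alone the Rayleigh quotient is exactly \<open>x\<close>.\<close>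
  also have "\<dots> = x * (a\<^sup>2 + D * b\<^sup>2)"
    unfolding root[symmetric] by (simp add: power2_eq_square algebra_simps)
  finally have sum_F: "sum f F = x * (a\<^sup>2 + D * b\<^sup>2)" .
  have "(\<Sum>v\<in>verts G. (y v)\<^sup>2) = (\<Sum>v\<in>insert u N. (y v)\<^sup>2)"
    using N u by (intro sum.mono_neutral_right) (auto simp: y_def)
  also have "\<dots> = a\<^sup>2 + (\<Sum>v\<in>N. (y v)\<^sup>2)"
    using N(2) finN by (simp add: y_def)
  also have "(\<Sum>v\<in>N. (y v)\<^sup>2) = (\<Sum>v\<in>N. b\<^sup>2)"
    using N(2) by (intro sum.cong) (auto simp: y_def)
  finally have norm: "(\<Sum>v\<in>verts G. (y v)\<^sup>2) = a\<^sup>2 + D * b\<^sup>2"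
    by (simp add: D(2))
  have norm_pos: "a\<^sup>2 + D * b\<^sup>2 > 0"
    using a D by (intro add_pos_nonneg) simp_all
  have rayleigh: "sum f (arcs_ends G) \<le> rho_alpha \<alpha> G vs * (a\<^sup>2 + D * b\<^sup>2)"
    using rayleigh_rho_alpha[OF ord, of \<alpha> y] u by (auto simp: norm f_def)
  have "sum f F \<le> sum f (arcs_ends G)"
    using fin F f_nonneg by (intro sum_mono2) auto
  then have "x * (a\<^sup>2 + D * b\<^sup>2) \<le> rho_alpha \<alpha> G vs * (a\<^sup>2 + D * b\<^sup>2)"
    using rayleigh sum_F by simp
  then show "star_rho \<alpha> (out_degree G u) \<le> rho_alpha \<alpha> G vs"
    using norm_pos by (simp add: x_def D_def)
  assume full: "{w. u \<rightarrow>\<^bsub>G\<^esub> w} = verts G - {u}"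
    and "arcs_ends G \<noteq> {u} \<times> (verts G - {u}) \<union> (verts G - {u}) \<times> {u}"
  then have "arcs_ends G \<noteq> F"
    by (simp add: F_def N_def)
  \<comment> \<open>Since \<open>u\<close> is adjacent to every other vertex, an arc outside
    \<open>F\<close> joins two neighbours of \<open>u\<close>. It adds \<open>b\<^sup>2 > 0\<close>
    to the form without changing the norm.\<close>
  then obtain v w where vw: "(v, w) \<in> arcs_ends G - F"
    using F by (metis Diff_eq_empty_iff all_not_in_conv subset_antisym surj_pair)
  then have adj: "v \<rightarrow>\<^bsub>G\<^esub> w" "w \<rightarrow>\<^bsub>G\<^esub> v" and "(v, w) \<notin> F"
    using arcs_ends_symmetric[OF sym_arcs] by auto
  then have neq: "v \<noteq> u" "w \<noteq> u"
    by (auto simp: F_def N_def)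
  moreover have "v \<in> N" "w \<in> N"
    using full adj_in_verts[OF adj(1)] neq by (auto simp: N_def)
  ultimately have "f (v, w) = b\<^sup>2"
    by (simp add: f_def y_def b_def power2_eq_square algebra_simps)
  then have "sum f F < sum f (arcs_ends G)"
    using fin F f_nonneg vw b by (intro sum_strict_mono2[of _ _ "(v, w)"]) auto
  then have "x * (a\<^sup>2 + D * b\<^sup>2) < rho_alpha \<alpha> G vs * (a\<^sup>2 + D * b\<^sup>2)"
    using rayleigh sum_F by simp
  then show "star_rho \<alpha> (out_degree G u) < rho_alpha \<alpha> G vs"
    using norm_pos by (simp add: x_def D_def)
qed

text \<open>An eigenvector not vanishing at the centre makes \<open>k\<close> a root of the star's
  quadratic. Vanishing there is possible only for \<open>k = \<alpha>\<close>, which the assumption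
  that \<open>k\<close> exceeds \<open>star_rho\<close> excludes.\<close>

lemma eigenvalue_star_le:
  assumes ord: "vertex_ordering G vs" and \<alpha>: "0 \<le> \<alpha>" "\<alpha> < 1"
    and card: "card (verts G) \<ge> 2" and u: "u \<in> verts G"
    and ends: "arcs_ends G = {u} \<times> (verts G - {u}) \<union> (verts G - {u}) \<times> {u}"
    and k: "eigenvalue (A_alpha \<alpha> G vs) k"
  shows "k \<le> star_rho \<alpha> (real (card (verts G)) - 1)"
proof (rule ccontr)
  define m where "m = real (card (verts G)) - 1"
  assume "\<not> k \<le> star_rho \<alpha> (real (card (verts G)) - 1)"
  then have not_le: "\<not> k \<le> star_rho \<alpha> m"
    by (simp add: m_def)
  have m: "m \<ge> 1" "m = real (card (verts G - {u}))"
    using card u by (simp_all add: m_def)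
  have "\<alpha> * 1 \<le> \<alpha> * m"
    using m(1) \<alpha> by (intro mult_left_mono) simp_all
  moreover have "star_rho \<alpha> m > \<alpha> * m"
    using m \<alpha> by (intro star_rho_greater)
  ultimately have "k - \<alpha> > 0"
    using not_le by simp
  obtain z where nz: "\<exists>v\<in>verts G. z v \<noteq> 0"
    and z: "\<And>v. v \<in> verts G \<Longrightarrow> (\<Sum>w | v \<rightarrow>\<^bsub>G\<^esub> w. \<alpha> * z v + (1 - \<alpha>) * z w) = k * z v"
    using k unfolding eigenvalue_A_alpha_iff[OF ord] by (auto simp: sum_A_alpha_entry)
  have leaf: "(k - \<alpha>) * z v = (1 - \<alpha>) * z u" if v: "v \<in> verts G - {u}" for v
  proof -
    have "{w. v \<rightarrow>\<^bsub>G\<^esub> w} = {u}"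
      using v u unfolding ends by auto
    then show ?thesis
      using z[of v] v by (simp add: algebra_simps)
  qed
  have "{w. u \<rightarrow>\<^bsub>G\<^esub> w} = verts G - {u}"
    using u unfolding ends by auto
  then have "(\<Sum>w\<in>verts G - {u}. \<alpha> * z u + (1 - \<alpha>) * z w) = k * z u"
    using z[OF u] by simp
  then have centre: "(k - \<alpha> * m) * z u = (\<Sum>w\<in>verts G - {u}. (1 - \<alpha>) * z w)"
    by (simp add: sum.distrib m(2) right_diff_distrib[of _ k] mult_ac)
  have "(k - \<alpha> * m) * (k - \<alpha>) * z u = (\<Sum>w\<in>verts G - {u}. (1 - \<alpha>) * ((k - \<alpha>) * z w))"
    using arg_cong[OF centre, of "\<lambda>t. (k - \<alpha>) * t"] by (simp add: sum_distrib_left mult_ac)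
  also have "\<dots> = (\<Sum>w\<in>verts G - {u}. (1 - \<alpha>)\<^sup>2 * z u)"
    by (intro sum.cong) (simp_all add: leaf power2_eq_square)
  also have "\<dots> = (1 - \<alpha>)\<^sup>2 * m * z u"
    by (simp add: m(2))
  finally have "(k - \<alpha> * m) * (k - \<alpha>) * z u = (1 - \<alpha>)\<^sup>2 * m * z u" .
  moreover have "z u \<noteq> 0"
  proof
    assume "z u = 0"
    then have "z v = 0" if "v \<in> verts G" for v
      using leaf[of v] that \<open>k - \<alpha> > 0\<close> by (cases "v = u") auto
    with nz show False by blast
  qed
  ultimately have "(k - \<alpha> * m) * (k - \<alpha>) = (1 - \<alpha>)\<^sup>2 * m"
    by simp
  then show False
    using root_le_star_rho not_le by blast
qed

lemma rho_alpha_edgeless: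
  assumes "vertex_ordering G vs" "verts G \<noteq> {}" "arcs_ends G = {}"
  shows "rho_alpha \<alpha> G vs = 0"
  using eigenvalue_rho_alpha[OF assms(1,2), of \<alpha>] assms(3)
  unfolding eigenvalue_A_alpha_iff[OF assms(1)] by (auto simp: sum_A_alpha_entry)

end

text \<open>Two isolated vertices have gap 0, and the bound is 0 as well at \<open>n = 2\<close>.
  They attain equality without forming a star, hence the exception in the equivalence.\<close>

theorem theorem4p1:
  fixes G :: "('a, 'b) pre_digraph" and vs :: "'a list" and n :: nat and \<alpha> :: real
  assumes "graph G"
    and "card (verts G) = n"
    and "n \<ge> 2"
    and "vertex_ordering G vs"
    and "0 \<le> \<alpha>" and "\<alpha> < 1"
  shows "gamma_alpha \<alpha> G vs
           \<le> real n - 1 - \<alpha> * real n / 2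
              - sqrt (\<alpha>\<^sup>2 * (real n)\<^sup>2 + 4 * (1 - 2 * \<alpha>) * (real n - 1)) / 2
    \<and> (\<not> (n = 2 \<and> arcs G = {}) \<longrightarrow>
         (gamma_alpha \<alpha> G vs
            = real n - 1 - \<alpha> * real n / 2
               - sqrt (\<alpha>\<^sup>2 * (real n)\<^sup>2 + 4 * (1 - 2 * \<alpha>) * (real n - 1)) / 2
          \<longleftrightarrow> digraph_iso G (with_proj (star n))))"
proof -
  interpret graph G by (rule assms(1))
  note \<alpha> = assms(5,6)
  define m where "m = real n - 1"
  \<comment> \<open>The bound is the gap of the star with \<open>n - 1\<close> leaves.\<close>
  define B where "B = m - star_rho \<alpha> m"
  have bound_eq: "real n - 1 - \<alpha> * real n / 2
      - sqrt (\<alpha>\<^sup>2 * (real n)\<^sup>2 + 4 * (1 - 2 * \<alpha>) * (real n - 1)) / 2 = B"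
    by (simp add: B_def m_def star_rho_def add_divide_distrib)
  have m: "m \<ge> 1"
    using assms(3) by (simp add: m_def)
  have ne: "verts G \<noteq> {}"
    using assms(2,3) by auto
  have "max_degree G \<in> out_degree G ` verts G"
    unfolding max_degree_def using ne by (intro Max_in) auto
  then obtain u where u: "u \<in> verts G" and deg_u: "out_degree G u = max_degree G"
    by auto
  have adj: "{w. v \<rightarrow>\<^bsub>G\<^esub> w} \<subseteq> verts G - {v}" for v
    by (auto dest: adj_in_verts adj_not_same)
  have deg_le: "out_degree G v \<le> n - 1" if "v \<in> verts G" for v
    using card_mono[OF _ adj[of v]] that assms(2) by (simp add: out_degree_eq_card_adj)
  let ?star = "\<lambda>u. arcs_ends G = {u} \<times> (verts G - {u}) \<union> (verts G - {u}) \<times> {u}"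
  have iso: "digraph_iso G (with_proj (star n)) \<longleftrightarrow> (\<exists>u\<in>verts G. ?star u)"
    using assms(2,3) by (intro digraph_iso_star_iff) simp_all
  have upper: "gamma_alpha \<alpha> G vs \<le> B \<and>
      (\<not> (n = 2 \<and> arcs G = {}) \<longrightarrow> gamma_alpha \<alpha> G vs = B \<longrightarrow> ?star u)"
  \<comment> \<open>Edgeless graphs are treated apart because both the comparison with
    \<open>star_rho\<close> and the monotonicity of the gap start at degree 1.\<close>
  proof (cases "max_degree G = 0")
    case True
    have "\<not> v \<rightarrow>\<^bsub>G\<^esub> w" for v w
    proof
      assume vw: "v \<rightarrow>\<^bsub>G\<^esub> w"
      then have v: "v \<in> verts G" by (rule adj_in_verts)
      have "out_degree G v \<le> max_degree G"
        unfolding max_degree_def using v by (intro Max_ge) auto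
      then have "{w. v \<rightarrow>\<^bsub>G\<^esub> w} = {}"
        using True finite_subset[OF adj[of v]] by (simp add: out_degree_eq_card_adj)
      with vw show False by blast
    qed
    then have empty: "arcs_ends G = {}" by auto
    then have gamma: "gamma_alpha \<alpha> G vs = 0"
      using rho_alpha_edgeless[OF assms(4) ne] True by (simp add: gamma_alpha_def)
    show ?thesis
    proof (cases "n = 2")
      case True
      then have "B = 0"
        using star_gap_1[of \<alpha>] \<alpha> by (simp add: B_def m_def)
      with True gamma empty show ?thesis
        by (simp add: arcs_ends_def)
    next
      case False
      then have "1 + 1 \<le> m"
        using assms(3) by (simp add: m_def)
      then have "B > 0"
        using star_gap_strict_mono[OF \<alpha>, of 1 m] star_gap_1[of \<alpha>] \<alpha> by (simp add: B_def)
      with gamma show ?thesis by simp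
    qed
  next
    case False
    define D where "D = real (max_degree G)"
    have deg: "out_degree G u \<ge> 1"
      using False deg_u by simp
    have D: "D \<ge> 1"
      using False by (simp add: D_def)
    have "gamma_alpha \<alpha> G vs \<le> D - star_rho \<alpha> D"
      using rho_alpha_ge_star_rho(1)[OF assms(4) \<alpha> u deg] by (simp add: gamma_alpha_def D_def deg_u)
    moreover have "D - star_rho \<alpha> D < B" if "max_degree G \<noteq> n - 1"
    proof -
      have "max_degree G + 1 \<le> n - 1"
        using that deg_le[OF u] deg_u by simp
      then have "D + 1 \<le> m"
        by (simp add: D_def m_def)
      then show ?thesis
        unfolding B_def using \<alpha> D by (intro star_gap_strict_mono)
    qed
    moreover have "D - star_rho \<alpha> D = B" if "max_degree G = n - 1"
      using that assms(3) by (simp add: D_def B_def m_def)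
    \<comment> \<open>Below degree \<open>n - 1\<close> monotonicity already makes the bound strict;
      at degree \<open>n - 1\<close> an edge avoiding \<open>u\<close> does.\<close>
    moreover have "gamma_alpha \<alpha> G vs < B" if max: "max_degree G = n - 1" and "\<not> ?star u"
    proof -
      have "card {w. u \<rightarrow>\<^bsub>G\<^esub> w} = card (verts G - {u})"
        using max deg_u u assms(2) by (simp add: out_degree_eq_card_adj)
      then have "{w. u \<rightarrow>\<^bsub>G\<^esub> w} = verts G - {u}"
        using adj[of u] by (intro card_subset_eq) auto
      then show ?thesis
        using rho_alpha_ge_star_rho(2)[OF assms(4) \<alpha> u deg _ that(2)] assms(3)
        by (simp add: gamma_alpha_def B_def m_def deg_u max)
    qed
    ultimately show ?thesis
      by (cases "max_degree G = n - 1") force+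
  qed
  \<comment> \<open>The converse for a star: the centre gives maximum degree at least
    \<open>n - 1\<close>, and no eigenvalue exceeds \<open>star_rho \<alpha> m\<close>. The centre
    \<open>c\<close> need not be the vertex \<open>u\<close> chosen above.\<close>
  have "gamma_alpha \<alpha> G vs \<ge> B" if c: "c \<in> verts G" "?star c" for c
  proof -
    have "{w. c \<rightarrow>\<^bsub>G\<^esub> w} = verts G - {c}"
      using c by auto
    then have "out_degree G c = n - 1"
      using c assms(2) by (simp add: out_degree_eq_card_adj)
    moreover have "out_degree G c \<le> max_degree G"
      unfolding max_degree_def using c by (intro Max_ge) auto
    ultimately have "real (max_degree G) \<ge> m"
      using assms(3) by (simp add: m_def)
    moreover have "rho_alpha \<alpha> G vs \<le> star_rho \<alpha> m"
      unfolding m_def using eigenvalue_star_le[OF assms(4) \<alpha> _ c eigenvalue_rho_alpha[OF assms(4) ne]] assms(2,3)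
      by simp
    ultimately show ?thesis
      by (simp add: gamma_alpha_def B_def)
  qed
  then show ?thesis
    unfolding bound_eq iso using upper u by (metis order_antisym)
qed

end
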